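(* Let $N\ge 2$, $\alpha\in(0,1)$, $\lambda>0$, and let $p$ satisfy $$1+2\alpha<p<\frac{1+\alpha}{1-\alpha}.$$ Suppose $u\in C^{2\alpha+\beta}_{loc}(\mathbb{R}^N)\cap L^1(\mathbb{R}^N,\omega)$ for some $\beta>0$, where $\omega(y)=1/(1+|y|^{N+2\alpha})$, is a nonnegative solution of $$(-\Delta)^\alpha u=\lambda u-u^p\quad\text{in }\mathbb{R}^N.$$ Then $u$ must be a constant.
   Context: The fractional Laplacian is defined (up to a normalization constant) by $(-\Delta)^\alpha u(x)=\int_{\mathbb{R}^N}\frac{2u(x)-u(x+y)-u(x-y)}{|y|^{N+2\alpha}}\,dy$ for $x\in\mathbb{R}^N$. $L^1(\mathbb{R}^N,\omega)$ denotes the space of functions $u$ with $\int_{\mathbb{R}^N}|u(y)|\omega(y)\,dy<\infty$. *)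

theory Defs
  imports "HOL-Analysis.Analysis"
begin

definition holder_loc :: "real \<Rightarrow> ('a::real_normed_vector \<Rightarrow> 'b::real_normed_vector) \<Rightarrow> bool" where
  "holder_loc g f \<longleftrightarrow> continuous_on UNIV f \<and>
     (\<forall>K. compact K \<longrightarrow> (\<exists>C. \<forall>x\<in>K. \<forall>y\<in>K. norm (f x - f y) \<le> C * norm (x - y) powr g))"

text \<open>The space C^s_loc for 0 < s < 2: for s \<le> 1 this is C^{0,s}_loc, for 1 < s < 2 it
  is C^{1,s-1}_loc (differentiable, with locally (s-1)-Hoelder Frechet derivative).\<close>
definition C_loc :: "real \<Rightarrow> ('a::euclidean_space \<Rightarrow> real) \<Rightarrow> bool" where
  "C_loc s u \<longleftrightarrow>
     (if s \<le> 1 then holder_loc s u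
      else (\<exists>D :: 'a \<Rightarrow> ('a \<Rightarrow>\<^sub>L real).
              (\<forall>x. (u has_derivative blinfun_apply (D x)) (at x)) \<and> holder_loc (s - 1) D))"

text \<open>Fractional Laplacian (without normalisation constant), as in the paper.\<close>
definition frac_lap :: "real \<Rightarrow> ('a::euclidean_space \<Rightarrow> real) \<Rightarrow> 'a \<Rightarrow> real" where
  "frac_lap \<alpha> u x =
     (LINT y|lborel. (2 * u x - u (x + y) - u (x - y)) / norm y powr (real DIM('a) + 2 * \<alpha>))"

definition L1_weighted :: "real \<Rightarrow> ('a::euclidean_space \<Rightarrow> real) \<Rightarrow> bool" where
  "L1_weighted \<alpha> u \<longleftrightarrow>
     integrable lborel (\<lambda>y. u y / (1 + norm y powr (real DIM('a) + 2 * \<alpha>)))"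

end

theory Submission
  imports Defs
begin

text \<open>
  Everything is read off at points where \<^term>\<open>u\<close> touches an explicit function from one side, since
  there the second differences of \<^term>\<open>u\<close>, hence \<^term>\<open>frac_lap \<alpha> u\<close>, are controlled by those of
  that function.

  Upper bound: maximise \<open>u (1 - |x|\<^sup>2/R\<^sup>2)\<^sup>n\<close> over the ball of radius \<open>R\<close>. At the maximum the
  part of the integral outside that ball is at most a multiple of the weighted norm of \<^term>\<open>u\<close> times
  \<open>(1 - |x|\<^sup>2/R\<^sup>2)\<close> to the power \<open>- (N + 2\<alpha>)\<close>. For large \<open>n\<close> the absorption \<open>u\<^sup>p\<close>
  beats this, uniformly in \<open>R \<ge> 1\<close>; let \<open>R\<close> tend to infinity.

  Lower bound: if \<^term>\<open>u\<close> vanishes somewhere, it vanishes identically. Otherwise place the largest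
  multiple of a bump of radius \<open>R\<close>, centred anywhere, below \<^term>\<open>u\<close>. At the contact point
  \<open>(-\<Delta>)\<^sup>\<alpha> u\<close> is at most \<open>\<mu> R\<close> to the power \<open>-2\<alpha>\<close> times \<^term>\<open>u\<close>, with \<open>\<mu>\<close> independent of the
  centre; for large \<open>R\<close> this forces \<open>u\<close> to the power \<open>p - 1\<close> to be at least \<open>\<lambda>/2\<close> there.

  Finally, perturbed extremum points give \<open>\<lambda> t - t\<^sup>p \<ge> 0\<close> at the supremum and \<open>\<le> 0\<close> at the
  infimum, so both equal the positive root.
\<close>

section \<open>Integrability of the truncated kernel\<close>

text \<open>Dyadic decomposition: the shells inside the unit ball contribute a geometric series of
  ratio \<open>2 powr (2 * \<alpha> - s)\<close>, those outside one of ratio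
  \<open>2 powr (- 2 * \<alpha>)\<close>. Thus \<open>2 * \<alpha> < s\<close> gives convergence at
  the origin and \<open>0 < \<alpha>\<close> at infinity.\<close>

lemma integrable_truncated_kernel:
  fixes \<alpha> s :: real
  assumes "0 < \<alpha>" "2 * \<alpha> < s"
  shows "integrable lborel (\<lambda>y::'a::euclidean_space.
           min 1 (norm y powr s) / norm y powr (real DIM('a) + 2 * \<alpha>))"
proof (rule integrableI_bounded)
  define N where "N = real DIM('a)"
  define M where "M = N + 2 * \<alpha>"
  \<comment> \<open>\<open>A k\<close> bounds the kernel for norms between
    \<open>2 powr (- (k + 1))\<close> and \<open>2 powr (- k)\<close>, \<open>B k\<close> for norms
    between \<open>2 powr k\<close> and \<open>2 powr (k + 1)\<close>. Below, each shell is enlarged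
    to the full ball, which costs only a constant factor.\<close>
  define A where "A k = 2 powr (- s * real k) * 2 powr (M * (real k + 1))" for k :: nat
  define B where "B k = 2 powr (- M * real k)" for k :: nat
  define V where "V = unit_ball_vol N"
  let ?f = "\<lambda>y::'a. min 1 (norm y powr s) / norm y powr M"
  let ?a = "\<lambda>k (y::'a). ennreal (A k) * indicator (cball 0 (2 powr (- real k))) y"
  let ?b = "\<lambda>k (y::'a). ennreal (B k) * indicator (cball 0 (2 powr (real k + 1))) y"
  have s: "s > 0" and M: "M > 0" using assms by (auto simp: M_def N_def)
  have V: "V \<ge> 0" by (simp add: V_def N_def)
  have term_le_suminf: "h k \<le> suminf h" for h :: "nat \<Rightarrow> ennreal" and k
    using sum_le_suminf[of h "{k}"] by simp
  have bound: "ennreal (norm (?f y)) \<le> (\<Sum>k. ?a k y) + (\<Sum>k. ?b k y)" for y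
  proof (cases "y = 0")
    case False
    then have y: "norm y > 0" by simp
    have eq: "norm y = 2 powr (log 2 (norm y))" using y by simp
    show ?thesis
    proof (cases "norm y \<le> 1")
      case True
      define k where "k = nat \<lfloor>- log 2 (norm y)\<rfloor>"
      have l: "log 2 (norm y) \<le> 0" using True y by simp
      have k: "real k \<le> - log 2 (norm y)" "- log 2 (norm y) < real k + 1"
        using l unfolding k_def by linarith+
      have up: "norm y \<le> 2 powr (- real k)" using k eq by (smt (verit) powr_mono)
      have lo: "2 powr (- (real k + 1)) \<le> norm y" using k eq by (smt (verit) powr_mono)
      have "norm y powr s \<le> (2 powr (- real k)) powr s"
        by (rule powr_mono2) (use s up in auto)
      then have 1: "norm y powr s \<le> 2 powr (- s * real k)" by (simp add: powr_powr mult.commute)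
      have "(2 powr (- (real k + 1))) powr M \<le> norm y powr M"
        by (rule powr_mono2) (use M lo in auto)
      then have 2: "2 powr (- (M * (real k + 1))) \<le> norm y powr M"
        by (simp add: powr_powr algebra_simps)
      have "?f y \<le> 2 powr (- s * real k) / 2 powr (- (M * (real k + 1)))"
        by (rule frac_le) (use 1 2 in auto)
      also have "\<dots> = A k" by (simp only: A_def powr_minus_divide) simp
      finally have "ennreal (norm (?f y)) \<le> ennreal (A k)" by (intro ennreal_leI) simp
      also have "\<dots> = ?a k y" using up by simp
      also have "\<dots> \<le> (\<Sum>k. ?a k y)"
        by (rule term_le_suminf)
      finally show ?thesis by (simp add: add_increasing2)
    next
      case False
      define k where "k = nat \<lfloor>log 2 (norm y)\<rfloor>"
      have l: "log 2 (norm y) \<ge> 0" using False y by simp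
      have k: "real k \<le> log 2 (norm y)" "log 2 (norm y) < real k + 1"
        using l unfolding k_def by linarith+
      have up: "norm y \<le> 2 powr (real k + 1)" using k eq by (smt (verit) powr_mono)
      have lo: "2 powr (real k) \<le> norm y" using k eq by (smt (verit) powr_mono)
      have "(2 powr (real k)) powr M \<le> norm y powr M"
        by (rule powr_mono2) (use M lo in auto)
      then have 2: "2 powr (M * real k) \<le> norm y powr M"
        by (simp add: powr_powr mult.commute)
      have "?f y \<le> 1 / 2 powr (M * real k)"
        by (rule frac_le) (use 2 in auto)
      also have "\<dots> = B k" by (simp add: B_def powr_minus_divide)
      finally have "ennreal (norm (?f y)) \<le> ennreal (B k)" by (intro ennreal_leI) simp
      also have "\<dots> = ?b k y" using up by simp
      also have "\<dots> \<le> (\<Sum>k. ?b k y)"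
        by (rule term_le_suminf)
      finally show ?thesis by (simp add: add_increasing)
    qed
  qed simp
  have ia: "(\<integral>\<^sup>+y. ?a k y \<partial>lborel) = ennreal (V * 2 powr M * (2 powr (2 * \<alpha> - s)) ^ k)" for k
  proof -
    have "(\<integral>\<^sup>+y. ?a k y \<partial>lborel) = ennreal (A k) * ennreal (V * (2 powr (- real k)) ^ DIM('a))"
      by (subst nn_integral_cmult_indicator) (simp_all add: emeasure_cball V_def N_def)
    also have "\<dots> = ennreal (A k * (V * (2 powr (- real k)) ^ DIM('a)))"
      by (subst ennreal_mult) (auto simp: A_def V)
    also have "A k * (V * (2 powr (- real k)) ^ DIM('a)) = V * 2 powr M * (2 powr (2 * \<alpha> - s)) ^ k"
      by (simp add: A_def M_def N_def powr_powr powr_add[symmetric] powr_realpow[symmetric]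
          algebra_simps)
    finally show ?thesis .
  qed
  have ib: "(\<integral>\<^sup>+y. ?b k y \<partial>lborel) = ennreal (V * 2 powr N * (2 powr (- 2 * \<alpha>)) ^ k)" for k
  proof -
    have "(\<integral>\<^sup>+y. ?b k y \<partial>lborel) = ennreal (B k) * ennreal (V * (2 powr (real k + 1)) ^ DIM('a))"
      by (subst nn_integral_cmult_indicator) (simp_all add: emeasure_cball V_def N_def)
    also have "\<dots> = ennreal (B k * (V * (2 powr (real k + 1)) ^ DIM('a)))"
      by (subst ennreal_mult) (auto simp: B_def V)
    also have "B k * (V * (2 powr (real k + 1)) ^ DIM('a)) = V * 2 powr N * (2 powr (- 2 * \<alpha>)) ^ k"
      by (simp add: B_def M_def N_def powr_powr powr_add[symmetric] powr_realpow[symmetric]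
          algebra_simps)
    finally show ?thesis .
  qed
  have fin: "(\<Sum>k. ennreal (C * q ^ k)) < \<infinity>" if "0 \<le> C" "0 \<le> q" "q < 1" for C q :: real
    using that by (subst suminf_ennreal2) (auto intro!: summable_mult summable_geometric)
  have "(\<integral>\<^sup>+y. ennreal (norm (?f y)) \<partial>lborel) \<le>
        (\<integral>\<^sup>+y. (\<Sum>k. ?a k y) + (\<Sum>k. ?b k y) \<partial>lborel)"
    by (intro nn_integral_mono bound)
  also have "\<dots> = (\<Sum>k. \<integral>\<^sup>+y. ?a k y \<partial>lborel) + (\<Sum>k. \<integral>\<^sup>+y. ?b k y \<partial>lborel)"
  proof -
    have "?a k \<in> borel_measurable lborel" "?b k \<in> borel_measurable lborel" for k
      by (auto intro!: borel_measurable_times_ennreal borel_measurable_indicator)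
    note meas = this
    show ?thesis
      unfolding nn_integral_suminf[OF meas(1), symmetric] nn_integral_suminf[OF meas(2), symmetric]
      by (rule nn_integral_add) (intro borel_measurable_suminf_order meas)+
  qed
  also have "\<dots> < \<infinity>"
  proof -
    have "2 powr (2 * \<alpha> - s) < 2 powr 0" "2 powr (- 2 * \<alpha>) < 2 powr (0::real)"
      using assms by (intro powr_less_mono; simp)+
    then have "(\<Sum>k. ennreal (V * 2 powr M * (2 powr (2 * \<alpha> - s)) ^ k)) < \<infinity>"
      "(\<Sum>k. ennreal (V * 2 powr N * (2 powr (- 2 * \<alpha>)) ^ k)) < \<infinity>"
      using V by (intro fin; simp)+
    then show ?thesis
      unfolding ia ib infinity_ennreal_def ennreal_add_less_top by blast
  qed
  finally show "(\<integral>\<^sup>+y. ennreal (norm (min 1 (norm y powr s) /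
      norm y powr (real DIM('a) + 2 * \<alpha>))) \<partial>(lborel::'a measure)) < \<infinity>"
    by (simp add: M_def N_def)
qed measurable

section \<open>One-sided bounds and scaling for the fractional Laplacian\<close>

lemma integral_le_of_le:
  fixes f g :: "'a \<Rightarrow> real"
  assumes "integrable M g" "\<And>x. f x \<le> g x" "integral\<^sup>L M g \<le> B" "0 \<le> B"
  shows "integral\<^sup>L M f \<le> B"
proof (cases "integrable M f")
  case True
  then show ?thesis using integral_mono[OF True assms(1)] assms by fastforce
qed (use assms in \<open>simp add: not_integrable_integral_eq\<close>)

text \<open>The assumption \<^term>\<open>0 \<le> B\<close> covers the junk value 0 of the integral when the integrand
  is not integrable.\<close>
lemma frac_lap_le:
  fixes v :: "'a::euclidean_space \<Rightarrow> real"
  assumes "integrable lborel g" "(LINT y|lborel. g y) \<le> B" "0 \<le> B"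
    and "\<And>y. y \<noteq> 0 \<Longrightarrow> (2 * v x - v (x + y) - v (x - y)) / norm y powr (real DIM('a) + 2 * \<alpha>) \<le> g y"
    and "0 \<le> g 0"
  shows "frac_lap \<alpha> v x \<le> B"
  unfolding frac_lap_def
proof (rule integral_le_of_le[OF assms(1) _ assms(2,3)])
  show "(2 * v x - v (x + y) - v (x - y)) / norm y powr (real DIM('a) + 2 * \<alpha>) \<le> g y" for y
    using assms(4)[of y] assms(5) by (cases "y = 0") auto
qed

lemma frac_lap_uminus:
  "frac_lap \<alpha> (\<lambda>x. - v x) x = - frac_lap \<alpha> v x"
  unfolding frac_lap_def integral_minus[symmetric]
  by (intro Bochner_Integration.integral_cong refl) (simp add: minus_divide_left)

lemma integral_lborel_affine:
  fixes f :: "'a::euclidean_space \<Rightarrow> real"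
  assumes [measurable]: "f \<in> borel_measurable borel" and "c \<noteq> 0"
  shows "(LINT y|lborel. f y) = \<bar>c\<bar> ^ DIM('a) * (LINT y|lborel. f (x + c *\<^sub>R y))"
  using assms(2) by (subst lborel_affine[of c x]) (auto simp: integral_density integral_distr)

lemma integrable_lborel_affine:
  fixes f :: "'a::euclidean_space \<Rightarrow> real"
  assumes f: "integrable lborel f" and c: "c \<noteq> 0"
  shows "integrable lborel (\<lambda>y. f (x + c *\<^sub>R y))"
proof -
  have [measurable]: "f \<in> borel_measurable borel"
    using borel_measurable_integrable[OF f] by simp
  have "integrable (density (distr lborel borel (\<lambda>y. x + c *\<^sub>R y)) (\<lambda>_. \<bar>c\<bar> ^ DIM('a))) f"
    using f lborel_affine[OF c, of x] by simp
  then have "integrable lborel (\<lambda>y. \<bar>c\<bar> ^ DIM('a) *\<^sub>R f (x + c *\<^sub>R y))"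
    by (subst (asm) integrable_density) (auto simp: integrable_distr_eq)
  then show ?thesis using c by simp
qed

text \<open>The kernel scales by \<open>R powr (N + 2 * \<alpha>)\<close> and Lebesgue measure takes
  back \<open>R ^ N\<close>. This reduces comparison with bumps of any centre and radius to the unit
  bump at the origin.\<close>

lemma frac_lap_affine:
  fixes u :: "'a::euclidean_space \<Rightarrow> real"
  assumes "R > 0" and [measurable]: "u \<in> borel_measurable borel"
  shows "frac_lap \<alpha> (\<lambda>x. u (z + R *\<^sub>R x)) x = R powr (2 * \<alpha>) * frac_lap \<alpha> u (z + R *\<^sub>R x)"
proof -
  define M where "M = real DIM('a) + 2 * \<alpha>"
  define w where "w = z + R *\<^sub>R x"
  let ?h = "\<lambda>y. (2 * u w - u (w + y) - u (w - y)) / norm y powr M"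
  have eq: "(2 * u w - u (z + R *\<^sub>R (x + y)) - u (z + R *\<^sub>R (x - y))) / norm y powr M
      = R powr M * ?h (R *\<^sub>R y)" for y
  proof -
    have "z + R *\<^sub>R (x + y) = w + R *\<^sub>R y" "z + R *\<^sub>R (x - y) = w - R *\<^sub>R y"
      by (simp_all add: w_def algebra_simps)
    then show ?thesis using assms(1) by (simp add: powr_mult)
  qed
  have pw: "R powr M = R powr (2 * \<alpha>) * R ^ DIM('a)"
    using assms by (simp add: M_def powr_add powr_realpow)
  have "(LINT y|lborel. ?h y) = R ^ DIM('a) * (LINT y|lborel. ?h (R *\<^sub>R y))"
    using assms(1) integral_lborel_affine[of ?h R 0] by simp
  then show ?thesis
    unfolding frac_lap_def M_def[symmetric] w_def[symmetric] eq integral_mult_right_zero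
    by (simp add: pw)
qed

section \<open>The bump and its second differences\<close>

definition bump :: "'a::euclidean_space \<Rightarrow> real" where
  "bump x = max 0 (1 - (norm x)\<^sup>2)"

lemma bump_nonneg: "0 \<le> bump x" and bump_le_1: "bump x \<le> 1" and bump_0: "bump 0 = 1"
  by (auto simp: bump_def)

lemma bump_eq_0: "norm x \<ge> 1 \<Longrightarrow> bump x = 0"
  by (simp add: bump_def)

lemma continuous_on_bump: "continuous_on A bump"
  unfolding bump_def by (intro continuous_intros)

text \<open>A maximum of semiconvex functions is semiconvex; only this one-sided bound is ever needed,
  so the kink of the bump on the unit sphere is harmless.\<close>
lemma bump_second_difference:
  "2 * bump x - bump (x + y) - bump (x - y) \<le> 2 * (norm y)\<^sup>2"
proof (cases "norm x \<ge> 1")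
  case True
  then show ?thesis using bump_nonneg[of "x + y"] bump_nonneg[of "x - y"]
    by (smt (verit) bump_eq_0 zero_le_power2)
next
  case False
  then have "bump x = 1 - (norm x)\<^sup>2" by (simp add: bump_def power_le_one)
  moreover have "bump (x + y) \<ge> 1 - (norm (x + y))\<^sup>2" "bump (x - y) \<ge> 1 - (norm (x - y))\<^sup>2"
    by (auto simp: bump_def)
  moreover have "(norm (x + y))\<^sup>2 + (norm (x - y))\<^sup>2 = 2 * (norm x)\<^sup>2 + 2 * (norm y)\<^sup>2"
    by (simp add: power2_norm_eq_inner inner_simps inner_commute)
  ultimately show ?thesis by linarith
qed

section \<open>Touching a function from below by a bump\<close>

text \<open>Subtracting \<open>\<epsilon>\<close> times a bump centred at an almost-minimum point
  creates a genuine global minimum. There the second differences of \<open>v\<close> are at most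
  \<open>\<epsilon>\<close> times those of the bump, so \<open>K\<close> depends only on
  \<open>\<alpha>\<close> and the dimension.\<close>

lemma ex_frac_lap_near_infimum:
  fixes \<alpha> :: real
  assumes "0 < \<alpha>" "\<alpha> < 1"
  obtains K where "\<And>(v::'a::euclidean_space \<Rightarrow> real) m \<epsilon> x\<^sub>0.
    \<lbrakk>continuous_on UNIV v; \<And>x. m \<le> v x; v x\<^sub>0 < m + \<epsilon>\<rbrakk> \<Longrightarrow>
    \<exists>x. v x < m + \<epsilon> \<and> frac_lap \<alpha> v x \<le> K * \<epsilon>"
proof -
  define M where "M = real DIM('a) + 2 * \<alpha>"
  define k where "k y = min 1 (norm y powr 2) / norm y powr M" for y :: 'a
  have k: "integrable lborel k"
    unfolding k_def M_def using assms by (intro integrable_truncated_kernel) auto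
  have k0: "0 \<le> k y" for y by (simp add: k_def)
  define K where "K = 2 * (LINT y|lborel. k y)"
  have K0: "K \<ge> 0" using k0 by (simp add: K_def)
  show thesis
  proof
    fix v :: "'a \<Rightarrow> real" and m \<epsilon> x0
    assume v: "continuous_on UNIV v" "\<And>x. m \<le> v x" "v x0 < m + \<epsilon>"
    have \<epsilon>: "\<epsilon> > 0" using v(2)[of x0] v(3) by linarith
    define w where "w x = v x - \<epsilon> * bump (x - x0)" for x
    have "continuous_on (cball x0 1) w"
      unfolding w_def
      by (intro continuous_intros continuous_on_subset[OF v(1)]
          continuous_on_compose2[OF continuous_on_bump]) auto
    from continuous_attains_inf[OF compact_cball _ this]
    obtain x1 where x1: "x1 \<in> cball x0 1" "\<And>x. x \<in> cball x0 1 \<Longrightarrow> w x1 \<le> w x"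
      by force
    \<comment> \<open>This strict inequality makes the minimum over the ball global: outside the
      ball \<open>w = v \<ge> m\<close>.\<close>
    have w1: "w x1 < m" using x1(2)[of x0] v(3) by (simp add: w_def bump_0)
    have min: "w x1 \<le> w x" for x
    proof (cases "x \<in> cball x0 1")
      case False
      then have "w x = v x" by (simp add: w_def bump_eq_0 dist_norm norm_minus_commute)
      then show ?thesis using w1 v(2)[of x] by linarith
    qed (rule x1)
    have "v x1 \<le> w x1 + \<epsilon> * 1"
      using mult_left_mono[OF bump_le_1[of "x1 - x0"], of \<epsilon>] \<epsilon> by (simp add: w_def)
    then have "v x1 < m + \<epsilon>" using w1 by simp
    moreover have "frac_lap \<alpha> v x1 \<le> K * \<epsilon>"
    proof (rule frac_lap_le[where g = "\<lambda>y. 2 * \<epsilon> * k y"])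
      show "(2 * v x1 - v (x1 + y) - v (x1 - y)) / norm y powr (real DIM('a) + 2 * \<alpha>) \<le> 2 * \<epsilon> * k y"
        if "y \<noteq> 0" for y
      proof -
        let ?b = "bump :: 'a \<Rightarrow> real"
        let ?D = "2 * ?b (x1 - x0) - ?b (x1 - x0 + y) - ?b (x1 - x0 - y)"
        have "2 * v x1 - v (x1 + y) - v (x1 - y) \<le> \<epsilon> * ?D"
          using min[of "x1 + y"] min[of "x1 - y"] by (simp add: w_def algebra_simps)
        also have "?D \<le> 2 * min 1 (norm y powr 2)"
          using bump_second_difference[of "x1 - x0" y] bump_le_1[of "x1 - x0"]
            bump_nonneg[of "x1 - x0 + y"] bump_nonneg[of "x1 - x0 - y"] that
          by (simp add: min_def)
        finally have "2 * v x1 - v (x1 + y) - v (x1 - y) \<le> \<epsilon> * (2 * min 1 (norm y powr 2))"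
          using \<epsilon> by simp
        from divide_right_mono[OF this, of "norm y powr M"] show ?thesis
          by (simp add: k_def M_def mult_ac)
      qed
    qed (use k K0 \<epsilon> k0 in \<open>auto simp: K_def\<close>)
    ultimately show "\<exists>x. v x < m + \<epsilon> \<and> frac_lap \<alpha> v x \<le> K * \<epsilon>" by blast
  qed
qed

text \<open>The point \<open>x\<close> is where the largest multiple of the bump below
  \<open>v\<close> touches \<open>v\<close>. The bound must be proportional to \<open>v x\<close>
  although the contact may lie close to the unit sphere, where the bump is tiny and its second
  differences are not. Since the operator is nonlocal, the bump near the origin, seen from
  \<open>x\<close>, pays for the difference.\<close>

lemma ex_frac_lap_le_mult:
  fixes \<alpha> :: real
  assumes \<alpha>: "0 < \<alpha>" "\<alpha> < 1"
  obtains \<mu> where "\<And>v::'a::euclidean_space \<Rightarrow> real.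
    \<lbrakk>continuous_on UNIV v; \<And>x. 0 < v x\<rbrakk> \<Longrightarrow> \<exists>x. v x \<le> v 0 \<and> frac_lap \<alpha> v x \<le> \<mu> * v x"
proof -
  define M where "M = real DIM('a) + 2 * \<alpha>"
  \<comment> \<open>The exponent \<open>1 + \<alpha>\<close> lies strictly between
    \<open>2 * \<alpha>\<close> and 2: above the first for integrability, below the second so that
    \<open>(norm y)\<^sup>2\<close> gains the small factor \<open>r powr (1 - \<alpha>)\<close> when
    \<open>norm y < r\<close>.\<close>
  define k where "k y = min 1 (norm y powr (1 + \<alpha>)) / norm y powr M" for y :: 'a
  have k: "integrable lborel k"
    unfolding k_def M_def using assms by (intro integrable_truncated_kernel) auto
  have k0: "0 \<le> k y" for y by (simp add: k_def)
  define I where "I = (LINT y|lborel. k y)"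
  have I: "I \<ge> 0" using k0 by (simp add: I_def)
  have M: "M > 0" using \<alpha> by (simp add: M_def)
  \<comment> \<open>By translation invariance \<open>W\<close> is the integral of
    \<open>indicator ?A - indicator ?B\<close> below, whatever the contact point. Subtracting the
    ball of radius 1/4 makes this difference nonpositive for \<open>norm y < r\<close>.\<close>
  define W where "W = measure lborel (ball (0::'a) (1/2)) - measure lborel (ball (0::'a) (1/4))"
  have "(1/4::real) ^ DIM('a) < (1/2) ^ DIM('a)" by (intro power_strict_mono) auto
  then have W: "W > 0"
    by (simp add: W_def content_ball unit_ball_vol_def Gamma_real_pos divide_strict_right_mono)
  \<comment> \<open>For \<open>y\<close> in \<open>?A\<close> the bump at \<open>x1 + y\<close> is
    at least 3/4 and \<open>norm y \<le> 2\<close>, so \<open>c * norm y powr M\<close> stays below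
    the bump.\<close>
  define c where "c = (3/4) / 2 powr M"
  have c: "c > 0" by (simp add: c_def)
  \<comment> \<open>\<open>\<delta>\<close> and \<open>r\<close> are solved backwards from
    \<open>rI\<close>, which says that the small-scale term is paid for by \<open>c * W\<close>. The
    summand 1 keeps the denominator positive when only \<open>I \<ge> 0\<close> is known.\<close>
  define \<delta> where "\<delta> = c * W / (2 * I + 1)"
  have \<delta>: "\<delta> > 0" using c W I by (simp add: \<delta>_def)
  define r where "r = min (1/4) (\<delta> powr (1 / (1 - \<alpha>)))"
  have r: "0 < r" "r \<le> 1/4" using \<delta> by (auto simp: r_def)
  have "r powr (1 - \<alpha>) \<le> (\<delta> powr (1 / (1 - \<alpha>))) powr (1 - \<alpha>)"
    using r \<alpha> by (intro powr_mono2) (auto simp: r_def)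
  also have "\<dots> = \<delta>" using \<alpha> \<delta> by (simp add: powr_powr)
  finally have r\<delta>: "r powr (1 - \<alpha>) \<le> \<delta>" .
  have rI: "2 * r powr (1 - \<alpha>) * I \<le> c * W"
  proof -
    have "2 * r powr (1 - \<alpha>) * I \<le> \<delta> * (2 * I)"
      using mult_right_mono[OF r\<delta>, of "2 * I"] I by (simp add: mult_ac)
    also have "\<dots> \<le> \<delta> * (2 * I + 1)" using \<delta> by (intro mult_left_mono) auto
    also have "\<dots> = c * W" using I by (simp add: \<delta>_def)
    finally show ?thesis .
  qed
  show thesis
  proof
    fix v :: "'a \<Rightarrow> real"
    assume v: "continuous_on UNIV v" "\<And>x. 0 < v x"
    have v0: "v x \<noteq> 0" for x using v(2)[of x] by simp
    have "continuous_on (cball 0 1) (\<lambda>x. bump x / v x)"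
      by (intro continuous_intros continuous_on_bump continuous_on_subset[OF v(1)])
        (auto simp: v0)
    from continuous_attains_sup[OF compact_cball _ this]
    obtain x1 where x1: "norm x1 \<le> 1" "\<And>x. norm x \<le> 1 \<Longrightarrow> bump x / v x \<le> bump x1 / v x1"
      by force
    \<comment> \<open>\<open>1 / q\<close> is the largest multiple of the bump lying below
      \<open>v\<close>, with contact at \<open>x1\<close>.\<close>
    define q where "q = bump x1 / v x1"
    have q0: "1 / v 0 \<le> q" using x1(2)[of 0] by (simp add: q_def bump_0)
    then have q: "q > 0" using v(2)[of 0] by (smt (verit) divide_pos_pos)
    have vx1: "v x1 = bump x1 / q" using q v0[of x1] by (auto simp: q_def field_simps)
    have ge: "bump x / q \<le> v x" for x
    proof (cases "norm x \<le> 1")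
      case True
      then show ?thesis using x1(2)[OF True] v(2)[of x] q by (simp add: q_def[symmetric] field_simps)
    next
      case False
      then show ?thesis using v(2)[of x] by (simp add: bump_eq_0)
    qed
    have "v x1 \<le> 1 / q" unfolding vx1 using q bump_le_1[of x1] by (simp add: divide_right_mono)
    also have "\<dots> \<le> v 0" using q0 q v(2)[of 0] by (simp add: field_simps)
    finally have le0: "v x1 \<le> v 0" .
    let ?A = "ball (- x1) (1/2)" and ?B = "ball (0::'a) (1/4)"
    \<comment> \<open>The first summand serves \<open>norm y < r\<close>, through the quadratic
      bound; the second serves \<open>norm y \<ge> r\<close>, where the second difference is at most
      \<open>2 * bump x1\<close>.\<close>
    define a where "a = 2 * r powr (1 - \<alpha>) + 2 * bump x1 * r powr (- (1 + \<alpha>))"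
    have a: "a \<ge> 0" using bump_nonneg[of x1] by (simp add: a_def)
    define g where "g y = (1 / q) * (a * k y - c * (indicator ?A y - indicator ?B y))" for y
    have iA: "integrable lborel (indicator ?A :: 'a \<Rightarrow> real)" "integrable lborel (indicator ?B :: 'a \<Rightarrow> real)"
      using emeasure_lborel_ball_finite by (auto intro!: integrable_real_indicator)
    have g: "integrable lborel g" unfolding g_def using k iA by auto
    have "(LINT y|lborel. g y) = (1 / q) * (a * I - c * (measure lborel ?A - measure lborel ?B))"
      unfolding g_def using k iA by (simp add: I_def)
    also have "measure lborel ?A - measure lborel ?B = W" by (simp add: W_def content_ball)
    \<comment> \<open>The part of \<open>a * I\<close> without the factor \<open>bump x1\<close> is
      cancelled by \<open>c * W\<close>; the rest is a multiple of
      \<open>bump x1 = q * v x1\<close>.\<close>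
    also have "a * I - c * W \<le> 2 * bump x1 * r powr (- (1 + \<alpha>)) * I"
      using rI by (simp add: a_def algebra_simps)
    also have "(1 / q) * \<dots> = (2 * r powr (- (1 + \<alpha>)) * I) * v x1" by (simp add: vx1)
    finally have gI: "(LINT y|lborel. g y) \<le> (2 * r powr (- (1 + \<alpha>)) * I) * v x1"
      using q by (simp add: divide_right_mono)
    \<comment> \<open>The negative term is the mass of the bump itself; it absorbs the small-scale term
      \<open>2 * r powr (1 - \<alpha>)\<close> even where the bump is close to 0.\<close>
    have key: "2 * bump x1 - bump (x1 + y) - bump (x1 - y) \<le>
        a * min 1 (norm y powr (1 + \<alpha>)) - c * (indicator ?A y - indicator ?B y) * norm y powr M"
      if y: "y \<noteq> 0" for y
    proof (cases "norm y < r")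
      case True
      have "(norm y)\<^sup>2 = norm y powr (1 - \<alpha>) * norm y powr (1 + \<alpha>)"
        using y by (simp flip: powr_add)
      also have "\<dots> \<le> r powr (1 - \<alpha>) * norm y powr (1 + \<alpha>)"
        using True \<alpha> by (intro mult_right_mono powr_mono2) auto
      finally have "2 * (norm y)\<^sup>2 \<le> 2 * r powr (1 - \<alpha>) * norm y powr (1 + \<alpha>)" by simp
      also have "\<dots> \<le> a * norm y powr (1 + \<alpha>)"
        using bump_nonneg[of x1] by (intro mult_right_mono) (auto simp: a_def)
      also have "norm y powr (1 + \<alpha>) = min 1 (norm y powr (1 + \<alpha>))"
        using True r \<alpha> by (simp add: powr_le1)
      finally have "2 * (norm y)\<^sup>2 \<le> a * min 1 (norm y powr (1 + \<alpha>))" .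
      moreover have "c * (indicator ?A y - indicator ?B y) * norm y powr M \<le> 0"
        using True r c by (auto simp: indicator_def mult_nonpos_nonneg)
      ultimately show ?thesis using bump_second_difference[of x1 y] by linarith
    next
      case False
      have "r powr (1 + \<alpha>) \<le> min 1 (norm y powr (1 + \<alpha>))"
        using False r \<alpha> by (auto simp: powr_le1 intro!: powr_mono2)
      then have "1 \<le> r powr (- (1 + \<alpha>)) * min 1 (norm y powr (1 + \<alpha>))"
        using r by (simp add: powr_minus field_simps del: minus_add_distrib)
      then have "2 * bump x1 * 1 \<le> 2 * bump x1 * (r powr (- (1 + \<alpha>)) * min 1 (norm y powr (1 + \<alpha>)))"
        using bump_nonneg[of x1] by (intro mult_left_mono) auto
      also have "\<dots> \<le> a * min 1 (norm y powr (1 + \<alpha>))"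
        unfolding a_def distrib_right by (simp add: mult.assoc)
      finally have 1: "2 * bump x1 \<le> a * min 1 (norm y powr (1 + \<alpha>))" by simp
      have 2: "c * (indicator ?A y - indicator ?B y) * norm y powr M \<le> bump (x1 + y)"
      proof (cases "y \<in> ?A \<and> y \<notin> ?B")
        case True
        then have n: "norm (x1 + y) < 1/2"
          by (simp add: dist_norm) (metis add.commute diff_minus_eq_add minus_diff_eq norm_minus_cancel)
        then have "norm y \<le> 2" using x1(1) norm_triangle_ineq4[of "x1 + y" x1] by simp
        then have "norm y powr M \<le> 2 powr M" using M by (intro powr_mono2) auto
        then have "c * norm y powr M \<le> 3/4" by (simp add: c_def field_simps)
        moreover have "(norm (x1 + y))\<^sup>2 \<le> (1/2)\<^sup>2" using n by (intro power_mono) auto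
        then have "3/4 \<le> bump (x1 + y)" by (simp add: bump_def power2_eq_square)
        ultimately show ?thesis using True by simp
      next
        case False
        then have "c * (indicator ?A y - indicator ?B y) * norm y powr M \<le> 0"
          using c by (auto simp: indicator_def mult_nonpos_nonneg)
        then show ?thesis using bump_nonneg[of "x1 + y"] by linarith
      qed
      show ?thesis using 1 2 bump_nonneg[of "x1 - y"] by linarith
    qed
    have "frac_lap \<alpha> v x1 \<le> (2 * r powr (- (1 + \<alpha>)) * I) * v x1"
    proof (rule frac_lap_le[OF g gI])
      show "0 \<le> 2 * r powr (- (1 + \<alpha>)) * I * v x1" using I v(2)[of x1] by simp
      show "0 \<le> g 0" using q c by (auto simp: g_def k_def indicator_def)
      show "(2 * v x1 - v (x1 + y) - v (x1 - y)) / norm y powr (real DIM('a) + 2 * \<alpha>) \<le> g y"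
        if y: "y \<noteq> 0" for y
      proof -
        have "2 * v x1 - v (x1 + y) - v (x1 - y) \<le> (1/q) * (2 * bump x1 - bump (x1 + y) - bump (x1 - y))"
          using ge[of "x1 + y"] ge[of "x1 - y"] by (simp add: vx1 diff_divide_distrib)
        also have "\<dots> \<le> (1/q) * (a * min 1 (norm y powr (1 + \<alpha>)) - c * (indicator ?A y - indicator ?B y) * norm y powr M)"
          using key[OF y] q by (intro mult_left_mono) auto
        also have "\<dots> = g y * norm y powr M"
        proof -
          have "min 1 (norm y powr (1 + \<alpha>)) = k y * norm y powr M" using y by (simp add: k_def)
          then show ?thesis by (simp only: g_def) (simp add: algebra_simps)
        qed
        finally show ?thesis using y by (simp add: M_def[symmetric] divide_le_eq)
      qed
    qed
    with le0 show "\<exists>x. v x \<le> v 0 \<and> frac_lap \<alpha> v x \<le> (2 * r powr (- (1 + \<alpha>)) * I) * v x" by blast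
  qed
qed

section \<open>Positive lower bound for positive solutions\<close>

text \<open>At the contact value \<open>U\<close> of a bump of radius \<open>R\<close> around
  \<open>z\<close>, \<open>R powr (2 * \<alpha>) * (lam * U - U powr p) \<le> \<mu> * U\<close>. For
  large \<open>R\<close> the right side takes at most half of the linear term, and
  \<open>U \<le> u z\<close> transfers the bound to \<open>z\<close>.\<close>

lemma solution_bounded_below:
  fixes u :: "'a::euclidean_space \<Rightarrow> real"
  assumes "0 < \<alpha>" "\<alpha> < 1" "0 < lam" "1 < p" and cont: "continuous_on UNIV u"
    and pos: "\<And>x. 0 < u x" and eq: "\<And>x. frac_lap \<alpha> u x = lam * u x - u x powr p"
  shows "\<exists>c>0. \<forall>x. c \<le> u x"
proof -
  obtain \<mu> where \<mu>: "\<And>v::'a \<Rightarrow> real. \<lbrakk>continuous_on UNIV v; \<And>x. 0 < v x\<rbrakk> \<Longrightarrow>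
      \<exists>x. v x \<le> v 0 \<and> frac_lap \<alpha> v x \<le> \<mu> * v x"
    using ex_frac_lap_le_mult[OF assms(1,2)] by blast
  \<comment> \<open>\<open>m\<close> is the required value of \<open>R powr (2 * \<alpha>)\<close>.
    The maximum with 1 keeps it positive, since the sign of \<open>\<mu>\<close> is unknown.\<close>
  define m where "m = max 1 (2 * \<mu> / lam)"
  define R where "R = m powr (1 / (2 * \<alpha>))"
  have m: "m \<ge> 1" "m \<ge> 2 * \<mu> / lam" by (auto simp: m_def)
  have R: "R > 0" "R powr (2 * \<alpha>) = m" using m assms by (auto simp: R_def powr_powr)
  have \<mu>m: "\<mu> \<le> m * (lam / 2)" using m(2) assms by (simp add: field_simps)
  have [measurable]: "u \<in> borel_measurable borel" using cont by (rule borel_measurable_continuous_onI)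
  have "(lam / 2) powr (1 / (p - 1)) \<le> u z" for z
  proof -
    have "continuous_on UNIV (\<lambda>x. u (z + R *\<^sub>R x))"
      by (intro continuous_on_compose2[OF cont] continuous_intros) auto
    from \<mu>[OF this] pos obtain x where x: "u (z + R *\<^sub>R x) \<le> u z"
      and le: "frac_lap \<alpha> (\<lambda>x. u (z + R *\<^sub>R x)) x \<le> \<mu> * u (z + R *\<^sub>R x)"
      by auto
    define U where "U = u (z + R *\<^sub>R x)"
    have U: "U > 0" using pos by (simp add: U_def)
    have "m * (lam * U - U powr p) \<le> \<mu> * U"
      using le R by (subst (asm) frac_lap_affine) (auto simp: eq U_def)
    also have "\<dots> \<le> m * (lam / 2) * U" using \<mu>m U by (intro mult_right_mono) auto
    finally have "m * (lam * U - U powr p) \<le> m * (lam / 2 * U)" by (simp add: mult.assoc)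
    then have "lam / 2 * U \<le> U powr p" using m(1)
      by (subst (asm) mult_le_cancel_left_pos) (auto simp: mult.commute)
    also have "U powr p = U powr (p - 1) * U" using U by (simp add: powr_diff)
    finally have "lam / 2 \<le> U powr (p - 1)" using U by simp
    then have "(lam / 2) powr (1 / (p - 1)) \<le> (U powr (p - 1)) powr (1 / (p - 1))"
      using assms by (intro powr_mono2) auto
    also have "\<dots> = U" using assms U by (simp add: powr_powr)
    finally show ?thesis using x by (simp add: U_def)
  qed
  then show ?thesis using assms(3) by (intro exI[of _ "(lam / 2) powr (1 / (p - 1))"]) auto
qed

section \<open>Elementary inequalities for the upper bound\<close>

text \<open>The linear coefficient is exact, so that first-order terms cancel when the bound is
  added at \<open>y\<close> and \<open>- y\<close>. The induction multiplies by
  \<open>1 / (1 - t) \<le> 1 + t + 2 * t\<^sup>2\<close>.\<close>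

lemma inverse_power_le_quadratic:
  "\<exists>C\<ge>0. \<forall>t::real. \<bar>t\<bar> \<le> 1/2 \<longrightarrow> (1 / (1 - t)) ^ n \<le> 1 + real n * t + C * t\<^sup>2"
proof (induction n)
  case 0
  show ?case by (intro exI[of _ 0]) auto
next
  case (Suc n)
  then obtain C where C: "C \<ge> 0" "\<And>t::real. \<bar>t\<bar> \<le> 1/2 \<Longrightarrow> (1 / (1 - t)) ^ n \<le> 1 + real n * t + C * t\<^sup>2"
    by blast
  show ?case
  proof (intro exI[of _ "2 + 2 * real n + 2 * C"] conjI allI impI)
    fix t :: real assume t: "\<bar>t\<bar> \<le> 1/2"
    have "1 / (1 - t) = 1 + t + t\<^sup>2 / (1 - t)" using t by (simp add: field_simps power2_eq_square)
    also have "t\<^sup>2 / (1 - t) \<le> t\<^sup>2 / (1/2)" using t by (intro divide_left_mono) auto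
    finally have 1: "1 / (1 - t) \<le> 1 + t + 2 * t\<^sup>2" by simp
    have t2: "t\<^sup>2 \<le> 1/4" using power_mono[OF t, of 2] by (simp add: power_divide)
    have "(1 / (1 - t)) ^ Suc n \<le> (1 + t + 2 * t\<^sup>2) * (1 + real n * t + C * t\<^sup>2)"
      unfolding power_Suc using t 1 C(2)[OF t] by (intro mult_mono) auto
    also have "\<dots> = 1 + real (Suc n) * t + t\<^sup>2 * (2 + real n + C + (2 * real n) * t + C * t + 2 * C * t\<^sup>2)"
      by (simp add: algebra_simps power2_eq_square)
    also have "\<dots> \<le> 1 + real (Suc n) * t + t\<^sup>2 * (2 + 2 * real n + 2 * C)"
    proof (intro add_left_mono mult_left_mono)
      have "(2 * real n) * t \<le> (2 * real n) * (1/2)" "C * t \<le> C * (1/2)" "2 * C * t\<^sup>2 \<le> 2 * C * (1/4)"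
        using t t2 C(1) by (intro mult_left_mono; simp)+
      then show "2 + real n + C + (2 * real n) * t + C * t + 2 * C * t\<^sup>2 \<le> 2 + 2 * real n + 2 * C"
        by simp
    qed simp
    finally show "(1 / (1 - t)) ^ Suc n \<le> 1 + real (Suc n) * t + (2 + 2 * real n + 2 * C) * t\<^sup>2"
      by (simp only: mult.commute[of "t\<^sup>2"])
  qed (use C in auto)
qed

lemma le_of_powr_le_affine:
  fixes k :: real
  assumes "1 < p" "0 \<le> A" "0 \<le> B" "k powr p \<le> A * k + B"
  shows "k \<le> max 1 ((A + B) powr (1 / (p - 1)))"
proof (cases "k \<le> 1")
  case False
  have "k powr (p - 1) * k = k powr p" using False by (simp add: powr_diff)
  also have "\<dots> \<le> A * k + B * k" using assms False mult_left_mono[of 1 k B] by simp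
  also have "\<dots> = (A + B) * k" by (simp add: distrib_right)
  finally have "k powr (p - 1) \<le> A + B" using False by simp
  then have "(k powr (p - 1)) powr (1 / (p - 1)) \<le> (A + B) powr (1 / (p - 1))"
    using assms False by (intro powr_mono2) auto
  then show ?thesis using assms False by (simp add: powr_powr)
qed simp

section \<open>Consequences of local regularity; zeros of a solution\<close>

lemma C_loc_continuous:
  assumes "C_loc s u" shows "continuous_on UNIV u"
  using assms unfolding C_loc_def holder_loc_def
  by (auto split: if_splits intro!: continuous_at_imp_continuous_on dest: has_derivative_continuous)

text \<open>For \<open>s > 1\<close> the linear terms \<open>D x y\<close> and
  \<open>D x (- y)\<close> cancel, and the Hoelder bound on the derivative controls both
  remainders.\<close>

lemma C_loc_second_difference:
  fixes u :: "'a::euclidean_space \<Rightarrow> real"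
  assumes "C_loc s u"
  shows "\<exists>C\<ge>0. \<forall>y. norm y \<le> 1 \<longrightarrow> \<bar>2 * u x - u (x + y) - u (x - y)\<bar> \<le> C * norm y powr s"
proof (cases "s \<le> 1")
  case True
  then obtain C where C: "\<And>a b. a \<in> cball x 1 \<Longrightarrow> b \<in> cball x 1 \<Longrightarrow> norm (u a - u b) \<le> C * norm (a - b) powr s"
    using assms compact_cball[of x 1] unfolding C_loc_def holder_loc_def by (metis (full_types))
  show ?thesis
  proof (intro exI[of _ "2 * \<bar>C\<bar>"] conjI allI impI)
    fix y :: 'a assume y: "norm y \<le> 1"
    have "C * norm y powr s \<le> \<bar>C\<bar> * norm y powr s" by (intro mult_right_mono) auto
    then show "\<bar>2 * u x - u (x + y) - u (x - y)\<bar> \<le> 2 * \<bar>C\<bar> * norm y powr s"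
      using C[of "x + y" x] C[of "x - y" x] y by (simp add: dist_norm)
  qed simp
next
  case False
  then obtain D :: "'a \<Rightarrow> 'a \<Rightarrow>\<^sub>L real" where D: "\<And>x. (u has_derivative blinfun_apply (D x)) (at x)"
    and h: "holder_loc (s - 1) D"
    using assms unfolding C_loc_def by auto
  from h obtain C where C: "\<And>a b. a \<in> cball x 1 \<Longrightarrow> b \<in> cball x 1 \<Longrightarrow> norm (D a - D b) \<le> C * norm (a - b) powr (s - 1)"
    using compact_cball[of x 1] unfolding holder_loc_def by (metis (full_types))
  have lin: "\<bar>u (x + y) - u x - D x y\<bar> \<le> \<bar>C\<bar> * norm y powr s" if y: "norm y \<le> 1" for y
  proof -
    have "norm (u (x + y) - u x - D x (x + y - x)) \<le> norm (x + y - x) * (\<bar>C\<bar> * norm y powr (s - 1))"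
    proof (rule differentiable_bound_linearization[where S = "cball x (norm y)"])
      show "x + t *\<^sub>R (x + y - x) \<in> cball x (norm y)" if "t \<in> {0..1}" for t
        using that by (simp add: dist_norm mult_left_le_one_le)
      show "(u has_derivative blinfun_apply (D z)) (at z within cball x (norm y))" for z
        using D has_derivative_at_withinI by blast
      show "onorm (blinfun_apply (D z) - blinfun_apply (D x)) \<le> \<bar>C\<bar> * norm y powr (s - 1)"
        if z: "z \<in> cball x (norm y)" for z
      proof -
        have zx: "norm (z - x) \<le> norm y" using z by (simp add: dist_norm norm_minus_commute)
        have "blinfun_apply (D z) - blinfun_apply (D x) = blinfun_apply (D z - D x)"
          by (simp add: fun_eq_iff blinfun.diff_left)
        then have "onorm (blinfun_apply (D z) - blinfun_apply (D x)) = norm (D z - D x)"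
          by (simp add: norm_blinfun.rep_eq)
        also have "\<dots> \<le> C * norm (z - x) powr (s - 1)"
          using C[of z x] z y by simp
        also have "\<dots> \<le> \<bar>C\<bar> * norm y powr (s - 1)"
          using zx False by (intro mult_mono powr_mono2) auto
        finally show ?thesis .
      qed
    qed simp
    also have "norm (x + y - x) * (\<bar>C\<bar> * norm y powr (s - 1)) = \<bar>C\<bar> * norm y powr s"
      by (cases "y = 0") (auto simp: powr_diff)
    finally show ?thesis by simp
  qed
  show ?thesis
  proof (intro exI[of _ "2 * \<bar>C\<bar>"] conjI allI impI)
    fix y :: 'a assume y: "norm y \<le> 1"
    show "\<bar>2 * u x - u (x + y) - u (x - y)\<bar> \<le> 2 * \<bar>C\<bar> * norm y powr s"
      using lin[of y] lin[of "- y"] y by (simp add: blinfun.minus_right)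
  qed simp
qed

text \<open>At a zero of \<open>u\<close> the integrand has one sign, so a vanishing integral makes
  it vanish almost everywhere, and continuity does the rest. Regularity near \<open>z\<close> and
  the bound \<open>K\<close> far away establish integrability, without which the value 0 could be
  the default value of the integral.\<close>

lemma frac_lap_0_at_zero:
  fixes u :: "'a::euclidean_space \<Rightarrow> real"
  assumes \<alpha>: "0 < \<alpha>" "2 * \<alpha> < s" and u: "C_loc s u" "\<And>x. 0 \<le> u x" "\<And>x. u x \<le> K"
    and zero: "u z = 0" "frac_lap \<alpha> u z = 0"
  shows "u x = 0"
proof -
  define M where "M = real DIM('a) + 2 * \<alpha>"
  have cont: "continuous_on UNIV u" using u(1) by (rule C_loc_continuous)
  have [measurable]: "u \<in> borel_measurable borel" using cont by (rule borel_measurable_continuous_onI)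
  obtain C where C: "C \<ge> 0" "\<And>y. norm y \<le> 1 \<Longrightarrow> \<bar>2 * u z - u (z + y) - u (z - y)\<bar> \<le> C * norm y powr s"
    using C_loc_second_difference[OF u(1)] by blast
  define f where "f y = (u (z + y) + u (z - y)) / norm y powr M" for y
  have f0: "f y \<ge> 0" for y using u(2) by (simp add: f_def)
  have K: "K \<ge> 0" using u(2,3) order_trans by blast
  have bound: "u (z + y) + u (z - y) \<le> (C + 2 * K) * min 1 (norm y powr s)" for y
  proof (cases "norm y \<le> 1")
    case True
    then have "u (z + y) + u (z - y) \<le> C * norm y powr s"
      using C(2)[of y] zero u(2)[of "z + y"] u(2)[of "z - y"] by simp
    also have "\<dots> \<le> (C + 2 * K) * norm y powr s" using K by (intro mult_right_mono) auto
    finally show ?thesis using True \<alpha> by (simp add: powr_le1)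
  next
    case False
    then have "norm y powr s \<ge> 1" using \<alpha> by (simp add: ge_one_powr_ge_zero)
    then show ?thesis using u(3)[of "z + y"] u(3)[of "z - y"] C(1) by simp
  qed
  have f: "integrable lborel f"
  proof (rule Bochner_Integration.integrable_bound)
    show "integrable lborel (\<lambda>y::'a. (C + 2 * K) * (min 1 (norm y powr s) / norm y powr M))"
      unfolding M_def using \<alpha> by (intro integrable_mult_right integrable_truncated_kernel)
    show "f \<in> borel_measurable lborel" unfolding f_def by measurable
    show "AE y in lborel. norm (f y) \<le> norm ((C + 2 * K) * (min 1 (norm y powr s) / norm y powr M))"
    proof (rule AE_I2)
      fix y :: 'a
      have "norm (f y) = f y" using f0 by simp
      also have "\<dots> \<le> (C + 2 * K) * min 1 (norm y powr s) / norm y powr M"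
        unfolding f_def by (intro divide_right_mono bound) auto
      also have "\<dots> \<le> norm ((C + 2 * K) * (min 1 (norm y powr s) / norm y powr M))"
        using C(1) K by (simp add: abs_mult)
      finally show "norm (f y) \<le> norm ((C + 2 * K) * (min 1 (norm y powr s) / norm y powr M))" .
    qed
  qed
  have "frac_lap \<alpha> u z = (LINT y|lborel. - f y)"
    unfolding frac_lap_def f_def M_def zero(1)
    by (intro Bochner_Integration.integral_cong refl) (simp add: minus_divide_left)
  then have "(LINT y|lborel. f y) = 0" using zero(2) by simp
  then have "AE y in lborel. f y = 0" using integral_nonneg_eq_0_iff_AE[OF f] f0 by simp
  \<comment> \<open>The point \<open>y = 0\<close> is set apart because division by zero gives
    \<open>f 0 = 0\<close>.\<close>
  then have AE: "AE y in lborel. y = 0 \<or> u (z + y) = 0"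
  proof eventually_elim
    case (elim y)
    then show ?case using u(2)[of "z + y"] u(2)[of "z - y"] by (auto simp: f_def add_nonneg_eq_0_iff)
  qed
  show "u x = 0"
  proof (rule ccontr)
    assume "u x \<noteq> 0"
    define S where "S = {y. u (z + y) \<noteq> 0}"
    have "x - z \<in> S" using \<open>u x \<noteq> 0\<close> by (simp add: S_def)
    moreover have "open S" unfolding S_def
      by (intro open_Collect_neq continuous_on_compose2[OF cont] continuous_intros) auto
    moreover have "S \<in> null_sets lborel"
    proof -
      have "0 \<notin> S" using zero(1) by (simp add: S_def)
      then have "AE y in lborel. y \<notin> S" using AE by (auto simp: S_def elim!: eventually_mono)
      then show ?thesis using \<open>open S\<close> by (subst AE_iff_null_sets) auto
    qed
    then have "negligible S" by (simp add: negligible_iff_null_sets null_sets_completionI)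
    ultimately show False using open_not_negligible by blast
  qed
qed

section \<open>Upper bound by a localised maximum\<close>

lemma solution_bounded_above:
  fixes u :: "'a::euclidean_space \<Rightarrow> real"
  assumes \<alpha>: "0 < \<alpha>" "\<alpha> < 1" and lam: "0 \<le> lam" and p: "1 < p" and cont: "continuous_on UNIV u"
    and nonneg: "\<And>x. 0 \<le> u x" and L1: "L1_weighted \<alpha> u"
    and eq: "\<And>x. frac_lap \<alpha> u x = lam * u x - u x powr p"
  obtains K where "\<And>x. u x \<le> K"
proof -
  define M where "M = real DIM('a) + 2 * \<alpha>"
  have M: "M > 0" using \<alpha> by (simp add: M_def)
  define k where "k y = min 1 (norm y powr 2) / norm y powr M" for y :: 'a
  have k: "integrable lborel k"
    unfolding k_def M_def using \<alpha> by (intro integrable_truncated_kernel) auto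
  have k0: "0 \<le> k y" for y by (simp add: k_def)
  define J where "J = (LINT y|lborel. k y)"
  have J: "J \<ge> 0" using k0 by (simp add: J_def)
  define W where "W y = u y / (1 + norm y powr M)" for y
  have W: "integrable lborel W" using L1 unfolding L1_weighted_def W_def M_def .
  have W0: "0 \<le> W y" for y using nonneg by (simp add: W_def add_nonneg_nonneg)
  \<comment> \<open>The estimate at the maximum contains \<open>G\<close> to the powers -2 and
    \<open>- M\<close>, where \<open>G\<close> is the cutoff there. The two conditions on
    \<open>n\<close> let the factor \<open>G powr (n * p)\<close> compensate both.\<close>
  obtain n :: nat where n: "max (2 / (p - 1)) (M / p) \<le> real n" using real_arch_simple by blast
  have n1: "2 \<le> real n * (p - 1)" and n2: "M \<le> real n * p"
    using n p by (simp_all add: field_simps)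
  obtain C where C: "C \<ge> 0" "\<And>t::real. \<bar>t\<bar> \<le> 1/2 \<Longrightarrow> (1 / (1 - t)) ^ n \<le> 1 + real n * t + C * t\<^sup>2"
    using inverse_power_le_quadratic by blast
  \<comment> \<open>\<open>2 * n\<close> comes from the linear terms at \<open>y\<close> and
    \<open>- y\<close>, and \<open>18 = 2 * 3\<^sup>2\<close> from the quadratic ones, with
    \<open>\<bar>t\<bar> \<le> 3 * e\<close>.\<close>
  define a where "a = 2 * real n + 18 * C"
  have a: "a \<ge> 0" using C by (simp add: a_def)
  define A where "A = lam + a * J"
  define T where "T = (LINT y|lborel. W y)"
  have T: "T \<ge> 0" using W0 by (simp add: T_def)
  have Wt: "integrable lborel (\<lambda>y. W (x + y))" "integrable lborel (\<lambda>y. W (x - y))" for x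
    using integrable_lborel_affine[OF W, of 1 x] integrable_lborel_affine[OF W, of "-1" x] by auto
  have "W \<in> borel_measurable borel" using borel_measurable_integrable[OF W] by simp
  then have TW: "(LINT y|lborel. W (x + y)) = T" "(LINT y|lborel. W (x - y)) = T" for x
    using integral_lborel_affine[of W 1 x] integral_lborel_affine[of W "-1" x] by (auto simp: T_def)
  define B where "B = 4 * 9 powr M * T"
  have B: "B \<ge> 0" using T by (simp add: B_def)
  have A: "A \<ge> 0" using lam a J by (simp add: A_def)
  define K where "K = max 1 ((A + B) powr (1 / (p - 1)))"
  have main: "u x * (1 - (norm x)\<^sup>2 / R\<^sup>2) ^ n \<le> K" if R: "1 \<le> R" and x: "norm x \<le> R" for R x
  proof -
    define g where "g x = 1 - (norm x)\<^sup>2 / R\<^sup>2" for x :: 'a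
    have R0: "R > 0" using R by simp
    have "continuous_on (cball 0 R) (\<lambda>x. u x * g x ^ n)"
      unfolding g_def by (intro continuous_intros continuous_on_subset[OF cont]) (use R0 in auto)
    from continuous_attains_sup[OF compact_cball _ this]
    obtain z where z: "norm z \<le> R" "\<And>x. norm x \<le> R \<Longrightarrow> u x * g x ^ n \<le> u z * g z ^ n"
      using R0 by force
    define \<kappa> where "\<kappa> = u z * g z ^ n"
    have "\<kappa> \<le> K"
    proof (cases "\<kappa> \<le> 0")
      case True
      then show ?thesis by (simp add: K_def)
    next
      case False
      have gz: "0 \<le> g z" "g z \<le> 1" using z(1) R0 power_mono[OF z(1), of 2] by (auto simp: g_def)
      define U where "U = u z"
      have U: "U > 0" using False nonneg[of z] gz by (auto simp: \<kappa>_def U_def mult_le_0_iff not_le)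
      define G where "G = g z"
      have G: "0 < G" "G \<le> 1"
      proof -
        show "G \<le> 1" using gz by (simp add: G_def)
        have "G \<noteq> 0"
        proof
          assume "G = 0"
          moreover have "n \<noteq> 0" using n1 by (metis mult_zero_left not_numeral_le_zero of_nat_0)
          ultimately show False using False by (simp add: \<kappa>_def G_def power_0_left)
        qed
        then show "0 < G" using gz by (simp add: G_def)
      qed
      \<comment> \<open>The 9 comes from the far region: there
        \<open>R \<le> 8 * norm y / G\<close>, so
        \<open>norm (z + w) \<le> R + norm y \<le> 9 * norm y / G\<close>.\<close>
      define \<gamma> where "\<gamma> = 2 * 9 powr M * G powr (- M)"
      \<comment> \<open>On the scale \<open>R * G\<close>, comparable to the distance from \<open>z\<close> to the sphere, the comparison
        function is of class \<open>C\<^sup>2\<close>; beyond it only integrability of \<open>u\<close> is available.\<close>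
      have pointwise: "u (z + y) + u (z - y) - 2 * U \<le>
          a * U / G\<^sup>2 * min 1 (norm y powr 2) + \<gamma> * norm y powr M * (W (z + y) + W (z - y))"
        if y: "y \<noteq> 0" for y
      proof (cases "norm y < R * G / 8")
        case True
        define e where "e = norm y / (R * G)"
        have e: "0 < e" "e \<le> 1/8" using True y R0 G by (auto simp: e_def field_simps)
        \<comment> \<open>\<open>t w\<close> is the relative loss of the cutoff, so maximality at
          \<open>z\<close> reads \<open>u (z + w) \<le> U * (1 / (1 - t w)) ^ n\<close>. The
          threshold \<open>R * G / 8\<close> gives \<open>\<bar>t w\<bar> \<le> 3/8\<close>, which
          keeps \<open>z + w\<close> in the ball and within the range of the quadratic
          bound.\<close>
        define t where "t w = ((norm (z + w))\<^sup>2 - (norm z)\<^sup>2) / (R\<^sup>2 * G)" for w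
        have gt: "g (z + w) = G * (1 - t w)" for w
        proof -
          have "G * t w = ((norm (z + w))\<^sup>2 - (norm z)\<^sup>2) / R\<^sup>2" using G by (simp add: t_def)
          then show ?thesis
            unfolding right_diff_distrib by (simp add: G_def g_def diff_divide_distrib)
        qed
        \<comment> \<open>The inner products with \<open>z\<close> cancel, leaving a sum of second
          order in \<open>e\<close> although each term is only of first order.\<close>
        have sum: "t y + t (- y) = 2 * G * e\<^sup>2"
        proof -
          have "(norm (z + y))\<^sup>2 + (norm (z - y))\<^sup>2 = 2 * (norm z)\<^sup>2 + 2 * (norm y)\<^sup>2"
            by (simp add: power2_norm_eq_inner inner_simps inner_commute)
          then have "t y + t (- y) = 2 * (norm y)\<^sup>2 / (R\<^sup>2 * G)"
            by (simp add: t_def flip: add_divide_distrib)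
          also have "\<dots> = 2 * G * e\<^sup>2" using R0 G by (simp add: e_def power2_eq_square field_simps)
          finally show ?thesis .
        qed
        have tb: "\<bar>t w\<bar> \<le> 3 * e" if w: "norm w = norm y" for w
        proof -
          have "(norm (z + w))\<^sup>2 - (norm z)\<^sup>2 = 2 * (z \<bullet> w) + (norm y)\<^sup>2"
            unfolding w[symmetric] by (simp add: power2_norm_eq_inner inner_simps inner_commute)
          moreover have "\<bar>z \<bullet> w\<bar> \<le> R * norm y"
            using Cauchy_Schwarz_ineq2[of z w] mult_right_mono[OF z(1), of "norm y"] w by simp
          moreover have "(norm y)\<^sup>2 \<le> R * norm y"
          proof -
            have "norm y \<le> R" using True R0 G mult_left_le[of G R] by linarith
            then show ?thesis by (simp add: power2_eq_square mult_right_mono)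
          qed
          ultimately have "\<bar>(norm (z + w))\<^sup>2 - (norm z)\<^sup>2\<bar> \<le> 3 * (R * norm y)"
            by (smt (verit) zero_le_power2)
          then have "\<bar>t w\<bar> \<le> 3 * (R * norm y) / (R\<^sup>2 * G)"
            using R0 G by (simp add: t_def abs_divide abs_mult divide_right_mono)
          also have "\<dots> = 3 * e" using R0 by (simp add: e_def power2_eq_square)
          finally show ?thesis .
        qed
        have ub: "u (z + w) \<le> U * (1 + real n * t w + C * (9 * e\<^sup>2))" if w: "norm w = norm y" for w
        proof -
          have t: "\<bar>t w\<bar> \<le> 1/2" using tb[OF w] e by linarith
          have pos: "0 < G * (1 - t w)" using G t by (intro mult_pos_pos) auto
          have "(norm (z + w))\<^sup>2 < R\<^sup>2" using pos R0 unfolding gt[symmetric] g_def by simp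
          then have "norm (z + w) \<le> R" using R0 by (simp add: power2_less_imp_less less_imp_le)
          from z(2)[OF this] have "u (z + w) * (G * (1 - t w)) ^ n \<le> U * G ^ n"
            by (simp add: gt U_def G_def)
          then have "u (z + w) \<le> U * G ^ n / (G * (1 - t w)) ^ n"
            using pos by (simp add: pos_le_divide_eq)
          also have "\<dots> = U * (1 / (1 - t w)) ^ n" using G by (simp add: power_mult_distrib power_divide)
          also have "\<dots> \<le> U * (1 + real n * t w + C * (9 * e\<^sup>2))"
          proof -
            have "(t w)\<^sup>2 \<le> (3 * e)\<^sup>2" using power_mono[OF tb[OF w], of 2] by simp
            then have "C * (t w)\<^sup>2 \<le> C * (9 * e\<^sup>2)"
              using C(1) by (intro mult_left_mono) (auto simp: power_mult_distrib)
            then show ?thesis using C(2)[OF t] U by (intro mult_left_mono) auto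
          qed
          finally show ?thesis .
        qed
        have "u (z + y) + u (z - y) - 2 * U \<le> U * (real n * (t y + t (- y)) + 18 * C * e\<^sup>2)"
          using ub[of y] ub[of "- y"] by (simp add: algebra_simps)
        also have "\<dots> = U * (G * (2 * real n * e\<^sup>2) + 18 * C * e\<^sup>2)" unfolding sum by (simp add: mult_ac)
        also have "\<dots> \<le> U * (2 * real n * e\<^sup>2 + 18 * C * e\<^sup>2)"
          using U G by (intro mult_left_mono add_right_mono mult_left_le_one_le) auto
        also have "\<dots> = a * U * e\<^sup>2" by (simp add: a_def algebra_simps)
        also have "\<dots> \<le> a * U * (min 1 (norm y powr 2) / G\<^sup>2)"
        proof (intro mult_left_mono)
          have "G\<^sup>2 * e\<^sup>2 \<le> 1 * 1" using G e by (intro mult_mono power_le_one) auto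
          moreover have "G\<^sup>2 * e\<^sup>2 = (norm y)\<^sup>2 / R\<^sup>2" using G by (simp add: e_def power_divide power_mult_distrib)
          moreover have "(norm y)\<^sup>2 / R\<^sup>2 \<le> (norm y)\<^sup>2 / 1"
            using R by (intro divide_left_mono) auto
          ultimately have "G\<^sup>2 * e\<^sup>2 \<le> min 1 (norm y powr 2)" using y by simp
          then show "e\<^sup>2 \<le> min 1 (norm y powr 2) / G\<^sup>2" using G by (simp add: pos_le_divide_eq mult.commute)
        qed (use a U in auto)
        finally have "u (z + y) + u (z - y) - 2 * U \<le> a * U / G\<^sup>2 * min 1 (norm y powr 2)" by simp
        moreover have "0 \<le> \<gamma> * norm y powr M * (W (z + y) + W (z - y))"
          using W0 by (simp add: \<gamma>_def)
        ultimately show ?thesis by linarith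
      next
        case False
        have far: "u (z + w) \<le> \<gamma> * norm y powr M * W (z + w)" if w: "norm w = norm y" for w
        proof -
          have Ry: "R \<le> 8 * norm y / G" using False G by (simp add: field_simps)
          have yG: "norm y \<le> norm y / G" using G by (simp add: pos_le_divide_eq mult_left_le)
          have "norm (z + w) \<le> R + norm y" using norm_triangle_ineq[of z w] z(1) w by simp
          then have b: "norm (z + w) \<le> 9 * norm y / G" using Ry yG by simp
          \<comment> \<open>Here \<open>R \<ge> 1\<close> lets the summand 1 of the weight be
            absorbed uniformly in \<open>R\<close>.\<close>
          have "1 \<le> 9 * norm y / G" using R Ry yG by simp
          then have "1 + norm (z + w) powr M \<le> (9 * norm y / G) powr M + (9 * norm y / G) powr M"
            using b M by (intro add_mono ge_one_powr_ge_zero powr_mono2) auto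
          also have "\<dots> = \<gamma> * norm y powr M"
            using G by (simp add: \<gamma>_def powr_divide powr_mult powr_minus_divide)
          finally have "W (z + w) * (1 + norm (z + w) powr M) \<le> W (z + w) * (\<gamma> * norm y powr M)"
            using W0 by (intro mult_left_mono) auto
          moreover have "W (z + w) * (1 + norm (z + w) powr M) = u (z + w)"
            by (simp add: W_def add_nonneg_eq_0_iff)
          ultimately show ?thesis by (simp add: mult.commute)
        qed
        have "0 \<le> a * U / G\<^sup>2 * min 1 (norm y powr 2)" using a U by simp
        then show ?thesis using far[of y] far[of "- y"] U by (simp add: distrib_left)
      qed
      have "frac_lap \<alpha> (\<lambda>x. - u x) z \<le> a * U / G\<^sup>2 * J + \<gamma> * (2 * T)"
      proof (rule frac_lap_le[where g = "\<lambda>y. a * U / G\<^sup>2 * k y + \<gamma> * (W (z + y) + W (z - y))"])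
        show "integrable lborel (\<lambda>y. a * U / G\<^sup>2 * k y + \<gamma> * (W (z + y) + W (z - y)))"
          using k Wt by (intro Bochner_Integration.integrable_add integrable_mult_right) auto
        have "(LINT y|lborel. a * U / G\<^sup>2 * k y + \<gamma> * (W (z + y) + W (z - y))) =
          a * U / G\<^sup>2 * J + \<gamma> * (T + T)"
          using k Wt[of z] TW[of z]
          by (subst Bochner_Integration.integral_add)
            (simp_all add: J_def del: times_divide_eq_left times_divide_eq_right)
        then show "(LINT y|lborel. a * U / G\<^sup>2 * k y + \<gamma> * (W (z + y) + W (z - y))) \<le>
          a * U / G\<^sup>2 * J + \<gamma> * (2 * T)" by simp
        show "0 \<le> a * U / G\<^sup>2 * J + \<gamma> * (2 * T)" using a U J T by (simp add: \<gamma>_def)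
        show "0 \<le> a * U / G\<^sup>2 * k 0 + \<gamma> * (W (z + 0) + W (z - 0))"
          using a U k0 W0 by (simp add: \<gamma>_def)
        fix y :: 'a assume y: "y \<noteq> 0"
        have "min 1 (norm y powr 2) = k y * norm y powr M" using y by (simp add: k_def)
        with pointwise[OF y] have "u (z + y) + u (z - y) - 2 * U \<le>
          (a * U / G\<^sup>2 * k y + \<gamma> * (W (z + y) + W (z - y))) * norm y powr M"
          by (simp add: algebra_simps)
        then show "(2 * - u z - - u (z + y) - - u (z - y)) / norm y powr (real DIM('a) + 2 * \<alpha>)
          \<le> a * U / G\<^sup>2 * k y + \<gamma> * (W (z + y) + W (z - y))"
          using y by (simp add: M_def[symmetric] U_def divide_le_eq)
      qed
      then have Up: "U powr p \<le> lam * U + a * U / G\<^sup>2 * J + \<gamma> * (2 * T)"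
        by (simp add: frac_lap_uminus eq U_def)
      have \<kappa>: "\<kappa> = U * G powr real n" using G by (simp add: \<kappa>_def U_def G_def powr_realpow)
      \<comment> \<open>Multiplying by \<open>q\<close> turns \<open>U powr p\<close> into
        \<open>\<kappa> powr p\<close>, and an inequality for \<open>\<kappa>\<close> alone, free of
        \<open>G\<close> and \<open>R\<close>, results.\<close>
      define q where "q = G powr (real n * p)"
      have "\<kappa> powr p = U powr p * q" using U G by (simp add: \<kappa> powr_mult powr_powr q_def)
      also have "\<dots> \<le> (lam * U + a * U / G\<^sup>2 * J + \<gamma> * (2 * T)) * q"
        using Up by (intro mult_right_mono) (auto simp: q_def)
      also have "\<dots> = lam * (U * q) + a * J * (U * (q / G\<^sup>2)) + B * (q * G powr (- M))"
        by (simp add: B_def \<gamma>_def algebra_simps)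
      also have "\<dots> \<le> lam * \<kappa> + a * J * \<kappa> + B * 1"
      proof -
        have "q = G powr (real n * (p - 1)) * G powr real n"
          by (simp add: q_def algebra_simps flip: powr_add)
        moreover have "G powr (real n * (p - 1)) \<le> 1" using G n1 by (intro powr_le1) auto
        ultimately have 1: "q \<le> G powr real n" by (simp add: mult_left_le_one_le)
        have "q / G\<^sup>2 = G powr (real n * (p - 1) - 2) * G powr real n"
        proof -
          have "q / G\<^sup>2 = G powr (real n * p - 2)" using G by (simp add: q_def powr_diff)
          also have "real n * p - 2 = (real n * (p - 1) - 2) + real n" by (simp add: algebra_simps)
          finally show ?thesis by (simp only: powr_add)
        qed
        moreover have "G powr (real n * (p - 1) - 2) \<le> 1" using G n1 by (intro powr_le1) auto
        ultimately have 2: "q / G\<^sup>2 \<le> G powr real n" by (simp add: mult_left_le_one_le)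
        have "q * G powr (- M) = G powr (real n * p - M)" by (simp add: q_def flip: powr_add)
        also have "\<dots> \<le> 1" using G n2 by (intro powr_le1) auto
        finally have 3: "q * G powr (- M) \<le> 1" .
        show ?thesis unfolding \<kappa> using 1 2 3 U lam a J B
          by (intro add_mono mult_left_mono) auto
      qed
      finally have "\<kappa> powr p \<le> A * \<kappa> + B" by (simp add: A_def algebra_simps)
      then show ?thesis unfolding K_def using le_of_powr_le_affine[OF p A B] by blast
    qed
    with z(2)[OF x] show ?thesis by (simp add: \<kappa>_def g_def)
  qed
  have "u x \<le> K" for x
  proof (rule tendsto_upperbound)
    have "((\<lambda>R. (norm x)\<^sup>2 / R\<^sup>2) \<longlongrightarrow> 0) at_top"
      by (intro tendsto_divide_0[OF tendsto_const] filterlim_at_top_imp_at_infinity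
          filterlim_pow_at_top filterlim_ident) auto
    then have "((\<lambda>R. u x * (1 - (norm x)\<^sup>2 / R\<^sup>2) ^ n) \<longlongrightarrow> u x * (1 - 0) ^ n) at_top"
      by (intro tendsto_intros)
    then show "((\<lambda>R. u x * (1 - (norm x)\<^sup>2 / R\<^sup>2) ^ n) \<longlongrightarrow> u x) at_top" by simp
    show "\<forall>\<^sub>F R in at_top. u x * (1 - (norm x)\<^sup>2 / R\<^sup>2) ^ n \<le> K"
      using eventually_ge_at_top[of "max 1 (norm x)"]
      by eventually_elim (use main in auto)
  qed simp
  then show thesis by (rule that)
qed

section \<open>Sign of the reaction at the extrema and rigidity\<close>

text \<open>The infimum need not be attained, so perturbed minimum points with
  \<open>\<epsilon>\<close> tending to 0 replace a minimiser, and continuity of \<open>F\<close>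
  passes to the limit. A general \<open>F\<close> makes the result applicable to \<open>- u\<close>
  as well.\<close>

lemma reaction_nonpos_at_infimum:
  fixes v :: "'a::euclidean_space \<Rightarrow> real" and F :: "real \<Rightarrow> real"
  assumes \<alpha>: "0 < \<alpha>" "\<alpha> < 1" and cont: "continuous_on UNIV v" and bdd: "bdd_below (range v)"
    and eq: "\<And>x. frac_lap \<alpha> v x = F (v x)" and F: "isCont F (INF x. v x)"
  shows "F (INF x. v x) \<le> 0"
proof -
  define m where "m = (INF x. v x)"
  obtain K where K: "\<And>(v::'a \<Rightarrow> real) m \<epsilon> x\<^sub>0.
    \<lbrakk>continuous_on UNIV v; \<And>x. m \<le> v x; v x\<^sub>0 < m + \<epsilon>\<rbrakk> \<Longrightarrow>
    \<exists>x. v x < m + \<epsilon> \<and> frac_lap \<alpha> v x \<le> K * \<epsilon>"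
    using ex_frac_lap_near_infimum[OF \<alpha>] by blast
  have m: "m \<le> v x" for x unfolding m_def using bdd by (rule cINF_lower) simp
  define \<epsilon> where "\<epsilon> i = 1 / real (Suc i)" for i
  have \<epsilon>: "\<epsilon> \<longlonglongrightarrow> 0"
    unfolding \<epsilon>_def using LIMSEQ_inverse_real_of_nat by (simp add: inverse_eq_divide)
  have "\<exists>x. v x < m + \<epsilon> i \<and> F (v x) \<le> K * \<epsilon> i" for i
  proof -
    have "(INF x. v x) < m + \<epsilon> i" by (simp add: m_def \<epsilon>_def)
    then obtain x0 where "v x0 < m + \<epsilon> i" using cINF_less_iff[OF _ bdd] by auto
    from K[OF cont m this] show ?thesis by (simp add: eq)
  qed
  then obtain X where X: "\<And>i. v (X i) < m + \<epsilon> i" "\<And>i. F (v (X i)) \<le> K * \<epsilon> i" by metis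
  have "(\<lambda>i. v (X i)) \<longlonglongrightarrow> m"
  proof (rule tendsto_sandwich)
    show "(\<lambda>_::nat. m) \<longlonglongrightarrow> m" by (rule tendsto_const)
    show "(\<lambda>i. m + \<epsilon> i) \<longlonglongrightarrow> m" using tendsto_add[OF tendsto_const \<epsilon>, of m] by simp
  qed (simp_all add: m less_imp_le[OF X(1)])
  then have "(\<lambda>i. F (v (X i))) \<longlonglongrightarrow> F m"
    using F isCont_tendsto_compose unfolding m_def by blast
  moreover have "(\<lambda>i. K * \<epsilon> i) \<longlonglongrightarrow> 0" using tendsto_mult_left[OF \<epsilon>, of K] by simp
  ultimately have "F m \<le> 0" by (rule LIMSEQ_le) (use X(2) in auto)
  then show ?thesis by (simp add: m_def)
qed

theorem theorem1p1:
  fixes u :: "'a::euclidean_space \<Rightarrow> real" and \<alpha> lam p :: real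
  assumes "DIM('a) \<ge> 2"
    and "0 < \<alpha>" "\<alpha> < 1" "lam > 0"
    and "1 + 2 * \<alpha> < p" "p < (1 + \<alpha>) / (1 - \<alpha>)"
    and "\<exists>\<beta>>0. 2 * \<alpha> + \<beta> < 2 \<and> C_loc (2 * \<alpha> + \<beta>) u"
    and "L1_weighted \<alpha> u"
    and "\<forall>x. u x \<ge> 0"
    and "\<forall>x. frac_lap \<alpha> u x = lam * u x - u x powr p"
  shows "\<exists>c. \<forall>x. u x = c"
proof -
  note \<alpha> = assms(2,3) and lam = assms(4)
  have p: "1 < p" using assms by simp
  have nonneg: "0 \<le> u x" and eq: "frac_lap \<alpha> u x = lam * u x - u x powr p" for x
    using assms by auto
  obtain s where s: "2 * \<alpha> < s" "C_loc s u"
    using assms(7) by (metis less_add_same_cancel1)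
  have cont: "continuous_on UNIV u" using s(2) by (rule C_loc_continuous)
  obtain K where K: "\<And>x. u x \<le> K"
    using solution_bounded_above[OF \<alpha> less_imp_le[OF lam] p cont nonneg assms(8) eq] by blast
  show ?thesis
  proof (cases "\<exists>z. u z = 0")
    case True
    then obtain z where z: "u z = 0" by blast
    then have "frac_lap \<alpha> u z = 0" by (simp add: eq)
    then show ?thesis using frac_lap_0_at_zero[OF \<alpha>(1) s nonneg K z] by blast
  next
    case False
    then have pos: "0 < u x" for x using nonneg[of x] by (metis order_le_less)
    obtain c where c: "c > 0" "\<And>x. c \<le> u x"
      using solution_bounded_below[OF \<alpha> lam p cont pos eq] by blast
    define m where "m = (INF x. u x)"
    \<comment> \<open>The supremum is written through the infimum of \<open>- u\<close>, in the form
      the preceding lemma uses.\<close>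
    define S where "S = - (INF x. - u x)"
    have bdd: "bdd_below (range u)" "bdd_below (range (\<lambda>x. - u x))"
      using c(2) K bdd_belowI2[of UNIV c u] bdd_belowI2[of UNIV "- K" "\<lambda>x. - u x"] by auto
    have mu: "m \<le> u x" and uS: "u x \<le> S" for x
      using cINF_lower[OF bdd(1), of x] cINF_lower[OF bdd(2), of x] by (auto simp: m_def S_def)
    \<comment> \<open>The uniform lower bound rules out the root 0 of the reaction, which would also
      satisfy the inequality at the infimum.\<close>
    have m: "m > 0" using cINF_greatest[of UNIV c u] c by (auto simp: m_def)
    then have S: "S > 0" using mu uS by (meson less_le_trans)
    have "lam * m - m powr p \<le> 0"
      unfolding m_def
      by (rule reaction_nonpos_at_infimum[OF \<alpha> cont bdd(1) eq])
        (use m in \<open>auto intro!: continuous_intros simp: m_def\<close>)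
    then have "lam * m \<le> m powr (p - 1) * m" using m by (simp add: powr_diff)
    then have lm: "lam \<le> m powr (p - 1)" using m by simp
    \<comment> \<open>With \<open>t = - u x\<close>, the function \<open>- u\<close> satisfies the
      equation with reaction \<open>- (lam * - t - (- t) powr p)\<close>.\<close>
    have "- (lam * S - S powr p) \<le> 0"
      unfolding S_def
      by (rule reaction_nonpos_at_infimum[where F = "\<lambda>t. - (lam * - t - (- t) powr p)", OF \<alpha> _ bdd(2)])
        (use S cont in \<open>auto intro!: continuous_intros simp: S_def frac_lap_uminus eq\<close>)
    then have "S powr (p - 1) * S \<le> lam * S" using S by (simp add: powr_diff)
    then have "S powr (p - 1) \<le> lam" using S by simp
    with lm have "S powr (p - 1) \<le> m powr (p - 1)" by linarith
    then have "S \<le> m" using m S p by (meson powr_less_mono2 diff_gt_0_iff_gt less_imp_le not_le)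
    then have "u x = m" for x using mu[of x] uS[of x] by linarith
    then show ?thesis by blast
  qed
qed

end
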